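(* Let $(A_m)_{m\ge 0}$ be a sequence of real numbers such that $\sum_{m\ge 0}\frac{A_m}{m!}x^m$ converges for every real $x$, and put $f(x)=e^{-x}\sum_{m=0}^{\infty}\frac{A_m}{m!}x^m$. Then for every integer $N\ge 0$ and every integer $n\ge 2$, \[ \left|f(n)-\sum_{m=0}^{N}\frac{\Delta^mA_n}{m!}\,\tau_m(-n)\right|\le 9(N+1)\,n^{\frac{N+1}{2}}\,E\!\left(f^{(N+1)};n\right). \]
   Context: $\Delta A_m=A_{m+1}-A_m$ and $\Delta^k$ is its $k$-fold iterate; $f^{(k)}(x)=e^{-x}\sum_m\frac{\Delta^kA_m}{m!}x^m$ and $E(f^{(k)};r)=e^{-r}\sum_{m=0}^\infty\frac{|\Delta^kA_m|}{m!}r^m$ for $r\ge0$. The polynomials $\tau_m(x)$ are defined for all real $x$ by $\sum_{m\ge0}\frac{\tau_m(x)}{m!}z^m=\bigl((1+z)e^{-z}\bigr)^x$. *)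

theory Defs
  imports "HOL-Analysis.Analysis"
begin

definition fdiff :: "(nat \<Rightarrow> real) \<Rightarrow> nat \<Rightarrow> real"
  where "fdiff A m = A (Suc m) - A m"

definition poisson_transform :: "(nat \<Rightarrow> real) \<Rightarrow> real \<Rightarrow> real"
  where "poisson_transform A x = exp (- x) * (\<Sum>m. A m / fact m * x ^ m)"

text \<open>
  The functional \<open>E(f; r)\<close> is represented on the sequence \<open>A\<close> underlying
  \<open>f = poisson_transform A\<close>.  By \<open>higher_deriv_poisson_transform\<close> below, the sequence
  underlying the \<open>k\<close>-th derivative of \<open>f\<close> is \<open>(fdiff ^^ k) A\<close>, so \<open>E(f^(k); r)\<close> is
  \<open>poisson_majorant ((fdiff ^^ k) A) r\<close>.
\<close>

definition poisson_majorant :: "(nat \<Rightarrow> real) \<Rightarrow> real \<Rightarrow> real"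
  where "poisson_majorant A r = exp (- r) * (\<Sum>m. \<bar>A m\<bar> / fact m * r ^ m)"

text \<open>
  \<open>tau m x\<close> is \<open>\<tau>\<^sub>m(x)\<close>.  The generating identity is read on the unit disc, where the base of
  the real power is positive; \<open>tau_gen_unique\<close> and \<open>tau_sums\<close> show that the description is
  well defined.
\<close>

definition tau :: "nat \<Rightarrow> real \<Rightarrow> real"
  where "tau m x = (THE t :: nat \<Rightarrow> real. \<forall>z. \<bar>z\<bar> < 1 \<longrightarrow>
           (\<lambda>k. t k / fact k * z ^ k) sums (((1 + z) * exp (- z)) powr x)) m"

lemma powser_coeff_zero:
  fixes d :: "nat \<Rightarrow> real"
  assumes "\<And>z. \<bar>z\<bar> < 1 \<Longrightarrow> (\<lambda>k. d k * z ^ k) sums 0"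
  shows "d n = 0"
proof (induction n rule: less_induct)
  case (less n)
  have "(\<lambda>i. d (i + n) * z ^ i) sums 0" if z: "z \<noteq> 0" "norm z < 1" for z
  proof -
    have "(\<lambda>i. d (i + n) * z ^ (i + n)) sums (0 - (\<Sum>i<n. d i * z ^ i))"
      using sums_split_initial_segment[OF assms, of z n] z by simp
    also have "(\<Sum>i<n. d i * z ^ i) = 0"
      using less by simp
    finally have "(\<lambda>i. d (i + n) * z ^ (i + n) / z ^ n) sums 0"
      using sums_divide[of _ 0 "z ^ n"] by fastforce
    then show ?thesis using z by (simp add: power_add)
  qed
  then have "((\<lambda>_. 0) \<longlongrightarrow> d (0 + n)) (at (0::real))"
    by (intro powser_limit_0_strong[where s = 1]) auto
  then show ?case
    using LIM_const_eq[of 0 "d n" 0] by simp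
qed

lemma tau_gen_unique:
  fixes s t :: "nat \<Rightarrow> real" and g :: "real \<Rightarrow> real"
  assumes "\<And>z. \<bar>z\<bar> < 1 \<Longrightarrow> (\<lambda>k. s k / fact k * z ^ k) sums g z"
    and "\<And>z. \<bar>z\<bar> < 1 \<Longrightarrow> (\<lambda>k. t k / fact k * z ^ k) sums g z"
  shows "s = t"
proof
  fix n
  have "(\<lambda>k. (s k / fact k - t k / fact k) * z ^ k) sums 0" if "\<bar>z\<bar> < 1" for z :: real
    using sums_diff[OF assms(1)[OF that] assms(2)[OF that]] by (simp add: algebra_simps)
  from powser_coeff_zero[OF this, of n] show "s n = t n" by simp
qed

lemma tau_gen_exists:
  fixes x z :: real
  assumes z: "\<bar>z\<bar> < 1"
  shows "(\<lambda>k. (fact k * (\<Sum>i\<le>k. (x gchoose i) * ((- x) ^ (k - i) / fact (k - i)))) / fact k * z ^ k)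
           sums (((1 + z) * exp (- z)) powr x)"
proof -
  let ?a = "\<lambda>i. (x gchoose i) * z ^ i"
  let ?b = "\<lambda>j. (- x * z) ^ j / fact j"
  have a: "?a sums ((1 + z) powr x)"
    using gen_binomial_real[OF z] .
  have sa: "summable (\<lambda>i. norm (?a i))"
  proof -
    obtain w where w: "\<bar>z\<bar> < w" "w < 1" using z dense by blast
    have "summable (\<lambda>i. (x gchoose i) * w ^ i)"
      using gen_binomial_real[of w x] w by (auto simp: sums_iff)
    then show ?thesis
      by (rule powser_insidea) (use w in auto)
  qed
  have b: "?b sums exp (- x * z)"
    using exp_converges[of "- x * z"] by (simp add: field_simps)
  have sb: "summable (\<lambda>j. norm (?b j))"
    using summable_norm_exp[of "- x * z"] by (simp add: field_simps)
  have "(\<lambda>k. \<Sum>i\<le>k. ?a i * ?b (k - i)) sums ((1 + z) powr x * exp (- x * z))"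
    using Cauchy_product_sums[OF sa sb] a b by (simp add: sums_iff)
  also have "(\<lambda>k. \<Sum>i\<le>k. ?a i * ?b (k - i)) =
    (\<lambda>k. (fact k * (\<Sum>i\<le>k. (x gchoose i) * ((- x) ^ (k - i) / fact (k - i)))) / fact k * z ^ k)"
  proof
    fix k
    have "?a i * ?b (k - i) = (x gchoose i) * ((- x) ^ (k - i) / fact (k - i)) * z ^ k"
      if "i \<le> k" for i
    proof -
      have "z ^ k = z ^ i * z ^ (k - i)" using that by (simp flip: power_add)
      then show ?thesis by (simp only: power_mult_distrib) simp
    qed
    then show "(\<Sum>i\<le>k. ?a i * ?b (k - i)) =
      (fact k * (\<Sum>i\<le>k. (x gchoose i) * ((- x) ^ (k - i) / fact (k - i)))) / fact k * z ^ k"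
      unfolding nonzero_mult_div_cancel_left[OF fact_nonzero] sum_distrib_right
      by (intro sum.cong refl) simp
  qed
  also have "(1 + z) powr x * exp (- x * z) = ((1 + z) * exp (- z)) powr x"
  proof -
    have "exp (- z) powr x = exp (- x * z)" by (simp add: powr_def)
    moreover have "((1 + z) * exp (- z)) powr x = (1 + z) powr x * exp (- z) powr x"
      by (rule powr_mult)
    ultimately show ?thesis by simp
  qed
  finally show ?thesis .
qed

lemma tau_eq:
  "tau m x = fact m * (\<Sum>i\<le>m. (x gchoose i) * ((- x) ^ (m - i) / fact (m - i)))"
proof -
  have "(THE t :: nat \<Rightarrow> real. \<forall>z. \<bar>z\<bar> < 1 \<longrightarrow>
           (\<lambda>k. t k / fact k * z ^ k) sums (((1 + z) * exp (- z)) powr x))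
        = (\<lambda>k. fact k * (\<Sum>i\<le>k. (x gchoose i) * ((- x) ^ (k - i) / fact (k - i))))"
  proof (rule the_equality)
    fix t :: "nat \<Rightarrow> real"
    assume "\<forall>z. \<bar>z\<bar> < 1 \<longrightarrow>
           (\<lambda>k. t k / fact k * z ^ k) sums (((1 + z) * exp (- z)) powr x)"
    then show "t = (\<lambda>k. fact k * (\<Sum>i\<le>k. (x gchoose i) * ((- x) ^ (k - i) / fact (k - i))))"
      using tau_gen_unique[of t "\<lambda>z. ((1 + z) * exp (- z)) powr x", OF _ tau_gen_exists] by blast
  qed (use tau_gen_exists in blast)
  then show ?thesis by (simp add: tau_def)
qed

lemma tau_sums:
  assumes "\<bar>z\<bar> < 1"
  shows "(\<lambda>m. tau m x / fact m * z ^ m) sums (((1 + z) * exp (- z)) powr x)"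
  using tau_gen_exists[OF assms] unfolding tau_eq .

lemma diffs_div_fact:
  fixes A :: "nat \<Rightarrow> real"
  shows "diffs (\<lambda>m. A m / fact m) = (\<lambda>m. A (Suc m) / fact m)"
  by (simp add: diffs_def fun_eq_iff del: of_nat_Suc)

lemma summable_fdiff:
  assumes "\<And>x::real. summable (\<lambda>m. A m / fact m * x ^ m)"
  shows "summable (\<lambda>m. fdiff A m / fact m * x ^ m)"
proof -
  have "summable (\<lambda>m. diffs (\<lambda>m. A m / fact m) m * x ^ m)"
    by (rule termdiff_converges_all) (rule assms)
  then have "summable (\<lambda>m. A (Suc m) / fact m * x ^ m)"
    by (simp add: diffs_div_fact)
  from summable_diff[OF this assms[of x]] show ?thesis
    by (simp add: fdiff_def algebra_simps diff_divide_distrib)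
qed

lemma poisson_transform_has_real_derivative:
  assumes "\<And>x::real. summable (\<lambda>m. A m / fact m * x ^ m)"
  shows "(poisson_transform A has_real_derivative poisson_transform (fdiff A) x) (at x)"
proof -
  let ?c = "\<lambda>m. A m / fact m"
  have d: "diffs ?c = (\<lambda>m. A (Suc m) / fact m)"
    by (rule diffs_div_fact)
  have s: "summable (\<lambda>m. diffs ?c m * x ^ m)"
    by (rule termdiff_converges_all) (rule assms)
  have "(\<Sum>m. fdiff A m / fact m * x ^ m) =
      (\<Sum>m. diffs ?c m * x ^ m) - (\<Sum>m. ?c m * x ^ m)"
    unfolding suminf_diff[OF s assms[of x]]
    by (simp add: d fdiff_def algebra_simps diff_divide_distrib)
  moreover have "((\<lambda>x. exp (- x) * (\<Sum>m. ?c m * x ^ m)) has_real_derivative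
      exp (- x) * ((\<Sum>m. diffs ?c m * x ^ m) - (\<Sum>m. ?c m * x ^ m))) (at x)"
    by (rule derivative_eq_intros termdiffs_strong_converges_everywhere assms refl)+
      (simp add: algebra_simps)
  ultimately show ?thesis
    unfolding poisson_transform_def[abs_def] by simp
qed

lemma higher_deriv_poisson_transform:
  assumes "\<And>x::real. summable (\<lambda>m. A m / fact m * x ^ m)"
  shows "(deriv ^^ k) (poisson_transform A) = poisson_transform ((fdiff ^^ k) A)"
proof -
  have s: "summable (\<lambda>m. (fdiff ^^ k) A m / fact m * x ^ m)" for k and x :: real
    by (induction k arbitrary: x) (use assms summable_fdiff in auto)
  show ?thesis
  proof (induction k)
    case (Suc k)
    then show ?case
      using DERIV_imp_deriv[OF poisson_transform_has_real_derivative[OF s]] by auto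
  qed simp
qed

end

theory Submission
  imports Defs
begin

text \<open>
  Write \<open>p\<^sub>m\<close> for the Poisson weights of mean \<open>n\<close>, so that \<open>f(n)\<close> is the mean of \<open>A\<close>.  Summation
  by parts away from the index \<open>n\<close>, iterated \<open>k\<close> times, gives
  \<open>f(n) = \<Sum>j<k. t\<^sub>j \<Delta>^j A\<^sub>n + \<Sum>m. h\<^sub>k(m) \<Delta>^k A\<^sub>m\<close>, where up to sign \<open>h\<^sub>k\<close> is the \<open>k\<close>-fold cumulative
  sum of \<open>p\<close> below \<open>n\<close> and the \<open>k\<close>-fold tail sum of \<open>p\<close> from \<open>n\<close> on, and \<open>t\<^sub>j\<close> is the total mass of
  \<open>h\<^sub>j\<close>.  The relation \<open>(m + 1) p\<^sub>m\<^sub>+\<^sub>1 = n p\<^sub>m\<close> propagates to a three-term recurrence in \<open>k\<close> for these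
  sums, which yields \<open>\<bar>h\<^sub>k(m)\<bar> \<le> \<surd>2 n^(k/2) p\<^sub>m\<close>, and hence a bound of the remainder by
  \<open>\<surd>2 n^(k/2) E(f^(k); n)\<close>.  Applied to \<open>A\<^sub>m = (1 + z)^m\<close> with \<open>z\<close> small, this bound makes the
  remainder vanish as \<open>k\<close> grows, so \<open>\<Sum>j. t\<^sub>j z^j = exp(n z) (1 + z)^(-n)\<close>, that is
  \<open>t\<^sub>j = \<tau>\<^sub>j(-n) / j!\<close>.
\<close>

section \<open>Poisson weights and their iterated one-sided sums\<close>

definition poisson_weight :: "real \<Rightarrow> nat \<Rightarrow> real"
  where "poisson_weight r m = exp (- r) * r ^ m / fact m"

primrec lower_sum :: "real \<Rightarrow> nat \<Rightarrow> nat \<Rightarrow> real"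
  where
    "lower_sum r 0 m = poisson_weight r m"
  | "lower_sum r (Suc k) m = (\<Sum>i\<le>m. lower_sum r k i)"

text \<open>Starting the tail at \<open>Suc m\<close> makes its increment from \<open>m\<close> to
  \<open>Suc m\<close> equal to minus the previous sum at \<open>Suc m\<close>, the mirror image of
  \<open>lower_sum_Suc_Suc\<close>.\<close>

primrec upper_sum :: "real \<Rightarrow> nat \<Rightarrow> nat \<Rightarrow> real"
  where
    "upper_sum r 0 m = poisson_weight r m"
  | "upper_sum r (Suc k) m = (\<Sum>i. upper_sum r k (i + Suc m))"

declare lower_sum.simps(2) [simp del] upper_sum.simps(2) [simp del]

text \<open>Cumulative sums from the left change sign at each summation by parts, while tails keep
  theirs; the index \<open>n\<close> itself is put on the upper side.\<close>

definition remainder_weight :: "nat \<Rightarrow> nat \<Rightarrow> nat \<Rightarrow> real"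
  where "remainder_weight n k m =
    (if m < n then (- 1) ^ k * lower_sum (real n) k m else upper_sum (real n) k m)"

lemma poisson_weight_nonneg: "0 \<le> r \<Longrightarrow> 0 \<le> poisson_weight r m"
  by (simp add: poisson_weight_def)

lemma poisson_weight_Suc: "(real m + 1) * poisson_weight r (Suc m) = r * poisson_weight r m"
  by (simp add: poisson_weight_def divide_simps)

lemma poisson_weight_mono_Suc:
  assumes "0 \<le> r" "real m + 1 \<le> r"
  shows "poisson_weight r m \<le> poisson_weight r (Suc m)"
proof -
  have "(real m + 1) * poisson_weight r m \<le> r * poisson_weight r m"
    using assms by (intro mult_right_mono poisson_weight_nonneg)
  then have "(real m + 1) * poisson_weight r m \<le> (real m + 1) * poisson_weight r (Suc m)"
    by (simp only: poisson_weight_Suc)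
  then show ?thesis
    by (rule mult_left_le_imp_le) simp
qed

lemma poisson_weight_antimono_Suc:
  assumes "0 \<le> r" "r \<le> real m + 1"
  shows "poisson_weight r (Suc m) \<le> poisson_weight r m"
proof -
  have "r * poisson_weight r m \<le> (real m + 1) * poisson_weight r m"
    using assms by (intro mult_right_mono poisson_weight_nonneg)
  then have "(real m + 1) * poisson_weight r (Suc m) \<le> (real m + 1) * poisson_weight r m"
    by (simp only: poisson_weight_Suc)
  then show ?thesis
    by (rule mult_left_le_imp_le) simp
qed

lemma lower_sum_nonneg: "0 \<le> r \<Longrightarrow> 0 \<le> lower_sum r k m"
  by (induction k arbitrary: m)
    (auto simp: lower_sum.simps(2) poisson_weight_nonneg intro!: sum_nonneg)

lemma lower_sum_0: "lower_sum r k 0 = poisson_weight r 0"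
  by (induction k) (auto simp: lower_sum.simps(2))

lemma lower_sum_Suc_Suc: "lower_sum r (Suc k) (Suc m) = lower_sum r (Suc k) m + lower_sum r k (Suc m)"
  by (simp add: lower_sum.simps(2))

text \<open>
  In terms of the generating function \<open>P(w) = exp (r * (w - 1))\<close> of the weights this is the
  derivative of \<open>P(w) / (1 - w)^k\<close>.
\<close>

lemma lower_sum_recurrence:
  "(real m + 1) * lower_sum r k (Suc m) = r * lower_sum r k m + real k * lower_sum r (Suc k) m"
proof (induction k arbitrary: m)
  case 0
  show ?case by (simp add: poisson_weight_Suc)
next
  case (Suc k)
  note IH = Suc.IH
  show ?case
  proof (induction m)
    case 0
    show ?case
      using IH[of 0] lower_sum_Suc_Suc[of r k 0]
      by (simp add: lower_sum_0 algebra_simps)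
  next
    case (Suc m)
    show ?case
      using Suc.IH IH[of "Suc m"] lower_sum_Suc_Suc[of r k "Suc m"]
        lower_sum_Suc_Suc[of r k m] lower_sum_Suc_Suc[of r "Suc k" m]
      by (simp add: algebra_simps)
  qed
qed

text \<open>Strict tails of \<open>(1/2) ^ m\<close> reproduce \<open>(1/2) ^ m\<close>, so one
  constant \<open>exp r\<close> serves for every \<open>k\<close>. This decay guarantees that the
  infinite sums defining \<open>upper_sum\<close> converge.\<close>

lemma upper_sum_decay:
  assumes "0 \<le> r"
  shows "0 \<le> upper_sum r k m \<and> upper_sum r k m \<le> exp r * (1/2) ^ m"
proof (induction k arbitrary: m)
  case 0
  \<comment> \<open>A single term of the exponential series at \<open>2 * r\<close> is at most its
    sum; doubling \<open>r\<close> produces the ratio 1/2.\<close>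
  have "(2 * r) ^ m / fact m \<le> exp (2 * r)"
    using sum_le_suminf[OF summable_exp_generic[of "2 * r"], of "{m}"] assms
    by (simp add: exp_def field_simps)
  then have "exp (- r) * ((2 * r) ^ m / fact m) \<le> exp (- r) * exp (2 * r)"
    by (intro mult_left_mono) auto
  also have "\<dots> = exp r"
    by (simp flip: exp_add)
  finally show ?case
    using assms by (simp add: poisson_weight_nonneg)
      (simp add: poisson_weight_def field_simps power_mult_distrib)
next
  case (Suc k)
  have g: "(\<lambda>i. exp r * (1/2) ^ (i + Suc m)) sums (exp r * (1/2) ^ m)"
    using sums_mult[OF geometric_sums[of "1/2::real"], of "exp r * (1/2) ^ Suc m"]
    by (simp add: power_add algebra_simps)
  have le: "0 \<le> upper_sum r k (i + Suc m)" "upper_sum r k (i + Suc m) \<le> exp r * (1/2) ^ (i + Suc m)" for i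
    using Suc by blast+
  have s: "summable (\<lambda>i. upper_sum r k (i + Suc m))"
  proof (rule summable_comparison_test'[OF sums_summable[OF g], of 0])
    show "norm (upper_sum r k (i + Suc m)) \<le> exp r * (1/2) ^ (i + Suc m)" for i
      using le[of i] by simp
  qed
  have "(\<Sum>i. upper_sum r k (i + Suc m)) \<le> exp r * (1/2) ^ m"
    using suminf_le[OF le(2) s sums_summable[OF g]] by (simp only: sums_unique[OF g, symmetric])
  moreover have "0 \<le> (\<Sum>i. upper_sum r k (i + Suc m))"
    by (rule suminf_nonneg[OF s le(1)])
  ultimately show ?case by (simp add: upper_sum.simps(2))
qed

lemma upper_sum_nonneg: "0 \<le> r \<Longrightarrow> 0 \<le> upper_sum r k m"
  using upper_sum_decay by blast

lemma summable_upper_sum: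
  assumes "0 \<le> r"
  shows "summable (upper_sum r k)"
proof (rule summable_comparison_test'[of _ 0])
  show "summable (\<lambda>m. exp r * (1/2) ^ m)"
    by (intro summable_mult summable_geometric) simp
qed (use upper_sum_decay[OF assms] in auto)

lemma upper_sum_tendsto_0:
  assumes "0 \<le> r"
  shows "upper_sum r k \<longlonglongrightarrow> 0" "(\<lambda>m. real m * upper_sum r k m) \<longlonglongrightarrow> 0"
proof -
  show "upper_sum r k \<longlonglongrightarrow> 0"
    by (rule summable_LIMSEQ_zero[OF summable_upper_sum[OF assms]])
  have "(\<lambda>m. exp r * (real m * (1/2) ^ m)) \<longlonglongrightarrow> exp r * 0"
    by (intro tendsto_mult tendsto_const powser_times_n_limit_0) simp
  then have lim: "(\<lambda>m. exp r * (real m * (1/2) ^ m)) \<longlonglongrightarrow> 0"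
    by simp
  have "norm (real m * upper_sum r k m) \<le> exp r * (real m * (1/2) ^ m)" for m
    using mult_left_mono[of "upper_sum r k m" "exp r * (1/2) ^ m" "real m"] upper_sum_decay[OF assms, of k m]
    by (simp add: mult.left_commute)
  then show "(\<lambda>m. real m * upper_sum r k m) \<longlonglongrightarrow> 0"
    by (intro Lim_null_comparison[OF always_eventually lim] allI)
qed

lemma upper_sum_Suc:
  assumes "0 \<le> r"
  shows "upper_sum r (Suc k) m = upper_sum r k (Suc m) + upper_sum r (Suc k) (Suc m)"
proof -
  have "summable (\<lambda>i. upper_sum r k (i + Suc m))"
    using summable_upper_sum[OF assms] by (subst summable_iff_shift)
  from suminf_split_head[OF this] show ?thesis
    by (simp add: upper_sum.simps(2))
qed

text \<open>Counterpart of \<open>lower_sum_recurrence\<close>, anchored at infinity because no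
  finite index gives a starting value.\<close>

lemma upper_sum_recurrence:
  assumes r: "0 \<le> r"
  shows "(real m + 1) * upper_sum r k (Suc m) + real k * upper_sum r (Suc k) m = r * upper_sum r k m"
proof (induction k arbitrary: m)
  case 0
  show ?case by (simp add: poisson_weight_Suc)
next
  case (Suc k)
  \<comment> \<open>The defect of the claimed identity does not depend on \<open>m\<close>, by the
    induction hypothesis, and tends to 0; hence it is 0.\<close>
  let ?e = "\<lambda>m. real (Suc m) * upper_sum r (Suc k) (Suc m)
    + real (Suc k) * upper_sum r (Suc (Suc k)) m - r * upper_sum r (Suc k) m"
  have step: "?e (Suc m) = ?e m" for m
    using Suc.IH[of "Suc m"] upper_sum_Suc[OF r, of k m] upper_sum_Suc[OF r, of k "Suc m"]
      upper_sum_Suc[OF r, of "Suc k" m]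
    by (simp add: algebra_simps)
  have const: "?e = (\<lambda>_. ?e m)"
  proof
    have "?e i = ?e 0" for i
      by (induction i) (simp_all only: step)
    then show "?e i = ?e m" for i by metis
  qed
  have "?e \<longlonglongrightarrow> 0 + real (Suc k) * 0 - r * 0"
    using upper_sum_tendsto_0[OF r]
    by (intro tendsto_intros LIMSEQ_Suc[of "\<lambda>m. real m * upper_sum r (Suc k) m"])
  then have "(\<lambda>_. ?e m) \<longlonglongrightarrow> 0"
    by (subst (asm) const) simp
  then have "?e m = 0"
    by (simp only: LIMSEQ_const_iff)
  then show ?case by (simp add: algebra_simps)
qed

section \<open>Bounds of the iterated sums by the weight at the same index\<close>

text \<open>The recurrences at \<open>k\<close> and \<open>Suc k\<close> combine to eliminate the
  values at \<open>Suc m\<close>. What remains relates three consecutive orders at a fixed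
  \<open>m\<close>, and below the mean one term has a favourable sign.\<close>

lemma lower_sum_Suc_Suc_le:
  assumes "0 \<le> r" "real m + 1 \<le> r"
  shows "real (Suc k) * lower_sum r (Suc (Suc k)) m \<le> r * lower_sum r k m + real k * lower_sum r (Suc k) m"
proof -
  have "real (Suc k) * lower_sum r (Suc (Suc k)) m
      = (real m + 1 - r) * lower_sum r (Suc k) m + (r * lower_sum r k m + real k * lower_sum r (Suc k) m)"
    using lower_sum_recurrence[of m r k] lower_sum_recurrence[of m r "Suc k"] lower_sum_Suc_Suc[of r k m]
    by (simp add: algebra_simps)
  moreover have "(real m + 1 - r) * lower_sum r (Suc k) m \<le> 0"
    using assms by (intro mult_nonpos_nonneg lower_sum_nonneg) auto
  ultimately show ?thesis by linarith
qed

text \<open>Same elimination above the mean. The order \<open>Suc k\<close> term is kept on the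
  left, since for \<open>k = 0\<close> it absorbs the extra term of
  \<open>upper_sum_1_square_le\<close>.\<close>

lemma upper_sum_Suc_Suc_le:
  assumes "0 \<le> r" "r \<le> real m"
  shows "real (Suc k) * upper_sum r (Suc (Suc k)) m + upper_sum r (Suc k) m \<le> r * upper_sum r k m"
proof -
  have "real (Suc k) * upper_sum r (Suc (Suc k)) m + upper_sum r (Suc k) m
      = (r - real m - real k) * upper_sum r (Suc k) m + r * upper_sum r k m"
    using upper_sum_recurrence[OF assms(1), of m k] upper_sum_recurrence[OF assms(1), of m "Suc k"]
      upper_sum_Suc[OF assms(1), of k m]
    by (simp add: algebra_simps)
  moreover have "(r - real m - real k) * upper_sum r (Suc k) m \<le> 0"
    using assms by (intro mult_nonpos_nonneg upper_sum_nonneg) auto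
  ultimately show ?thesis by linarith
qed

text \<open>Supplies order 1, which the step by two from order 0 cannot reach. The square telescopes
  into weights times sums of neighbouring cumulative sums, and the weights increase up to the
  mean.\<close>

lemma lower_sum_1_square_le:
  assumes r: "0 \<le> r"
  shows "real m \<le> r \<Longrightarrow> (lower_sum r 1 m)\<^sup>2 \<le> 2 * poisson_weight r m * lower_sum r 2 m"
proof (induction m)
  case 0
  show ?case
    using poisson_weight_nonneg[OF r, of 0] by (simp add: lower_sum_0 power2_eq_square)
next
  case (Suc m)
  let ?p = "poisson_weight r (Suc m)" and ?s = "lower_sum r 1 m" and ?s' = "lower_sum r 1 (Suc m)"
  have s': "?s' = ?s + ?p"
    using lower_sum_Suc_Suc[of r 0 m] by simp
  have p: "0 \<le> ?p" "poisson_weight r m \<le> ?p"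
    using poisson_weight_nonneg[OF r] poisson_weight_mono_Suc[OF r, of m] Suc.prems by auto
  have "?s'\<^sup>2 = ?s\<^sup>2 + ?p * (?s + ?s')"
    unfolding s' by (simp add: power2_eq_square algebra_simps)
  also have "?s\<^sup>2 \<le> 2 * poisson_weight r m * lower_sum r 2 m"
    using Suc by simp
  also have "\<dots> \<le> 2 * ?p * lower_sum r 2 m"
    using p lower_sum_nonneg[OF r] by (intro mult_right_mono mult_left_mono) auto
  also have "?p * (?s + ?s') \<le> 2 * ?p * ?s'"
    unfolding s' using p(1) by (simp add: algebra_simps)
  also have "2 * ?p * lower_sum r 2 m + 2 * ?p * ?s' = 2 * ?p * lower_sum r 2 (Suc m)"
    using lower_sum_Suc_Suc[of r 1 m] by (simp add: numeral_2_eq_2 algebra_simps)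
  finally show ?case by simp
qed

text \<open>The same telescoping run down from infinity, where the weights decrease: the difference
  \<open>v\<close> is nondecreasing from \<open>m\<close> on and tends to 0.\<close>

lemma upper_sum_1_square_le:
  assumes r: "0 \<le> r" "r \<le> real m"
  shows "(upper_sum r 1 m)\<^sup>2 \<le> poisson_weight r m * (upper_sum r 1 m + 2 * upper_sum r 2 m)"
proof -
  let ?p = "poisson_weight r" and ?s = "upper_sum r 1"
  \<comment> \<open>\<open>X i\<close> is the sum of \<open>?s j + ?s (Suc j)\<close> over all
    \<open>j\<close> from \<open>i\<close> on, the factor left by telescoping the squares.\<close>
  define X where "X i = ?s i + 2 * upper_sum r 2 i" for i
  define v where "v i = (?s i)\<^sup>2 - ?p i * X i" for i
  have X0: "0 \<le> X i" for i
    by (simp add: X_def upper_sum_nonneg r)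
  have step: "v i \<le> v (Suc i)" if "m \<le> i" for i
  proof -
    have s: "?s i = ?p (Suc i) + ?s (Suc i)"
      using upper_sum_Suc[OF r(1), of 0 i] by simp
    have X: "X i = X (Suc i) + (?s i + ?s (Suc i))"
      using upper_sum_Suc[OF r(1), of 1 i] s by (simp add: X_def numeral_2_eq_2)
    have "?p (Suc i) * X i \<le> ?p i * X i"
      using poisson_weight_antimono_Suc[OF r(1), of i] that r(2) X0
      by (intro mult_right_mono) auto
    moreover have "?p (Suc i) * X i = ?p (Suc i) * X (Suc i) + ?p (Suc i) * (?s i + ?s (Suc i))"
      by (simp add: X algebra_simps)
    moreover have "?p (Suc i) * (?s i + ?s (Suc i)) = (?s i)\<^sup>2 - (?s (Suc i))\<^sup>2"
      using s by (simp add: power2_eq_square algebra_simps)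
    ultimately show ?thesis
      unfolding v_def by linarith
  qed
  have "v m \<le> v (m + i)" for i
    by (induction i) (use step in \<open>auto intro: order_trans\<close>)
  moreover have "(\<lambda>i. v (m + i)) \<longlonglongrightarrow> 0"
  proof -
    have "v \<longlonglongrightarrow> 0\<^sup>2 - 0 * (0 + 2 * 0)"
      unfolding v_def X_def upper_sum.simps(1)[symmetric]
      by (intro tendsto_intros upper_sum_tendsto_0 r)
    then show ?thesis
      using LIMSEQ_ignore_initial_segment[of v 0 m] by (simp add: add.commute)
  qed
  ultimately have "v m \<le> 0"
    by (intro LIMSEQ_le_const) auto
  then show ?thesis by (simp add: v_def X_def)
qed

text \<open>Induction by two steps. The factor \<open>sqrt 2\<close> enters at order 1, through the
  2 in \<open>lower_sum_1_square_le\<close>, and is merely carried along afterwards.\<close>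

lemma lower_sum_le:
  assumes r: "1 \<le> r" "real m + 1 \<le> r"
  shows "lower_sum r k m \<le> sqrt 2 * sqrt r ^ k * poisson_weight r m"
proof -
  let ?p = "poisson_weight r m"
  have r0: "0 \<le> r" and p: "0 \<le> ?p" and sr: "sqrt r * sqrt r = r"
    using r poisson_weight_nonneg by auto
  show ?thesis
  proof (induction k rule: induct_nat_012)
    case 0
    have "1 * ?p \<le> sqrt 2 * ?p" by (intro mult_right_mono p) simp
    then show ?case by simp
  next
    case 1
    have "(lower_sum r 1 m)\<^sup>2 \<le> 2 * ?p * lower_sum r 2 m"
      using r by (intro lower_sum_1_square_le) auto
    also have "\<dots> \<le> 2 * ?p * (r * ?p)"
      using lower_sum_Suc_Suc_le[OF r0 r(2), of 0] p
      by (intro mult_left_mono) (auto simp: numeral_2_eq_2)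
    also have "\<dots> = (sqrt 2 * sqrt r * ?p)\<^sup>2"
      using r0 by (simp add: power_mult_distrib) (simp add: power2_eq_square)
    finally show ?case
      using power2_le_imp_le[of "lower_sum r 1 m"] p r0 by simp
  next
    case (ge2 k)
    let ?B = "sqrt 2 * sqrt r ^ Suc (Suc k) * ?p"
    have "real (Suc k) * lower_sum r (Suc (Suc k)) m \<le> r * lower_sum r k m + real k * lower_sum r (Suc k) m"
      by (rule lower_sum_Suc_Suc_le[OF r0 r(2)])
    also have "\<dots> \<le> ?B + real k * ?B"
    proof (intro add_mono mult_left_mono)
      have "r * lower_sum r k m \<le> r * (sqrt 2 * sqrt r ^ k * ?p)"
        using ge2 r0 by (intro mult_left_mono) auto
      also have "\<dots> = ?B"
        by (subst sr[symmetric]) (simp add: ac_simps)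
      finally show "r * lower_sum r k m \<le> ?B" .
      \<comment> \<open>Since \<open>1 <= r\<close>, the bound at order \<open>Suc k\<close> is at
        most the one at the next order, so both terms are compared with the same
        \<open>?B\<close>.\<close>
      have "sqrt 2 * sqrt r ^ Suc k * ?p \<le> ?B"
        using r p by (intro mult_left_mono mult_right_mono power_increasing) auto
      with ge2 show "lower_sum r (Suc k) m \<le> ?B"
        by linarith
    qed simp
    finally have "real (Suc k) * lower_sum r (Suc (Suc k)) m \<le> real (Suc k) * ?B"
      by (simp add: algebra_simps)
    then show ?case
      by (rule mult_left_le_imp_le) simp
  qed
qed

lemma upper_sum_le:
  assumes r: "0 \<le> r" "r \<le> real m"
  shows "upper_sum r k m \<le> sqrt 2 * sqrt r ^ k * poisson_weight r m"
proof -
  let ?p = "poisson_weight r m"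
  have p: "0 \<le> ?p" and sr: "sqrt r * sqrt r = r"
    using r poisson_weight_nonneg by auto
  show ?thesis
  proof (induction k rule: induct_nat_012)
    case 0
    have "1 * ?p \<le> sqrt 2 * ?p" by (intro mult_right_mono p) simp
    then show ?case by simp
  next
    case 1
    \<comment> \<open>Doubling this bounds \<open>upper_sum r 1 m + 2 * upper_sum r 2 m\<close> by
      \<open>2 * (r * ?p)\<close>.\<close>
    have *: "upper_sum r 2 m + upper_sum r 1 m \<le> r * ?p" "0 \<le> upper_sum r 1 m"
      using upper_sum_Suc_Suc_le[OF r, of 0] upper_sum_nonneg[OF r(1)] by (auto simp: numeral_2_eq_2)
    have "(upper_sum r 1 m)\<^sup>2 \<le> ?p * (upper_sum r 1 m + 2 * upper_sum r 2 m)"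
      by (rule upper_sum_1_square_le[OF r])
    also have "\<dots> \<le> ?p * (2 * (r * ?p))"
      using * p by (intro mult_left_mono) auto
    also have "\<dots> = (sqrt 2 * sqrt r * ?p)\<^sup>2"
      using r by (simp add: power_mult_distrib) (simp add: power2_eq_square)
    finally show ?case
      using power2_le_imp_le[of "upper_sum r 1 m"] p r by simp
  next
    case (ge2 k)
    have "1 * upper_sum r (Suc (Suc k)) m \<le> real (Suc k) * upper_sum r (Suc (Suc k)) m"
      using upper_sum_nonneg[OF r(1)] by (intro mult_right_mono) auto
    also have "\<dots> \<le> r * upper_sum r k m"
      using upper_sum_Suc_Suc_le[OF r, of k] upper_sum_nonneg[OF r(1), of "Suc k" m] by linarith
    also have "\<dots> \<le> r * (sqrt 2 * sqrt r ^ k * ?p)"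
      using ge2 r by (intro mult_left_mono) auto
    also have "\<dots> = sqrt 2 * sqrt r ^ Suc (Suc k) * ?p"
      by (subst sr[symmetric]) (simp add: ac_simps)
    finally show ?case by simp
  qed
qed

section \<open>The two-sided kernel and summation by parts\<close>

text \<open>The one-sided bounds cover every index: by integrality \<open>m < n\<close> gives
  \<open>real m + 1 <= real n\<close>, and otherwise \<open>real n <= real m\<close>.\<close>

lemma abs_remainder_weight_le:
  assumes "1 \<le> n"
  shows "\<bar>remainder_weight n k m\<bar> \<le> sqrt 2 * sqrt (real n) ^ k * poisson_weight (real n) m"
  using assms lower_sum_le[of "real n" m k] upper_sum_le[of "real n" m k]
    lower_sum_nonneg[of "real n" k m] upper_sum_nonneg[of "real n" k m]
  by (auto simp: remainder_weight_def abs_mult)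

lemma summable_remainder_weight:
  assumes "1 \<le> n"
  shows "summable (remainder_weight n k)"
proof (rule summable_comparison_test')
  show "summable (\<lambda>m. sqrt 2 * sqrt (real n) ^ k * upper_sum (real n) 0 m)"
    by (intro summable_mult summable_upper_sum) simp
qed (use abs_remainder_weight_le[OF assms] in auto)

lemma suminf_remainder_weight:
  assumes "1 \<le> n"
  shows "(\<Sum>m. remainder_weight n k m) = (- 1) ^ k * lower_sum (real n) (Suc k) (n - 1) + upper_sum (real n) k n
    + upper_sum (real n) (Suc k) n"
proof -
  have "(\<Sum>m. remainder_weight n k m) = (\<Sum>m. remainder_weight n k (m + Suc n)) + (\<Sum>m<Suc n. remainder_weight n k m)"
    by (rule suminf_split_initial_segment[OF summable_remainder_weight[OF assms]])
  also have "(\<Sum>m. remainder_weight n k (m + Suc n)) = upper_sum (real n) (Suc k) n"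
    by (simp add: upper_sum.simps(2) remainder_weight_def)
  also have "(\<Sum>m<Suc n. remainder_weight n k m) = (\<Sum>m<n. (- 1) ^ k * lower_sum (real n) k m) + upper_sum (real n) k n"
    by (simp add: remainder_weight_def)
  also have "(\<Sum>m<n. (- 1) ^ k * lower_sum (real n) k m) = (- 1) ^ k * lower_sum (real n) (Suc k) (n - 1)"
    using assms lessThan_Suc_atMost[of "n - 1"] by (simp add: lower_sum.simps(2) sum_distrib_left)
  finally show ?thesis by simp
qed

lemma remainder_weight_Suc_0:
  assumes "1 \<le> n"
  shows "remainder_weight n (Suc k) 0 = - remainder_weight n k 0"
  using assms by (simp add: remainder_weight_def lower_sum_0)

text \<open>The kernel of order \<open>Suc k\<close> is an antidifference of minus the kernel of
  order \<open>k\<close> after its total mass is removed at \<open>n\<close>. Removing this mass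
  lets one antidifference match the cumulative sums on the left and the tails on the right.\<close>

lemma remainder_weight_Suc_Suc:
  assumes "1 \<le> n"
  shows "remainder_weight n (Suc k) (Suc m)
    = remainder_weight n (Suc k) m - remainder_weight n k (Suc m) + (if Suc m = n then \<Sum>i. remainder_weight n k i else 0)"
proof -
  consider "Suc m < n" | "Suc m = n" | "n \<le> m" by linarith
  then show ?thesis
  proof cases
    case 1
    then show ?thesis by (simp add: remainder_weight_def lower_sum_Suc_Suc algebra_simps)
  next
    case 2
    then have "remainder_weight n (Suc k) m = - ((- 1) ^ k * lower_sum (real n) (Suc k) (n - 1))"
      by (auto simp: remainder_weight_def)
    then show ?thesis
      unfolding suminf_remainder_weight[OF assms] using 2 by (simp add: remainder_weight_def)
  next
    case 3
    then show ?thesis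
      using upper_sum_Suc[of "real n" k m] by (simp add: remainder_weight_def)
  qed
qed

lemma sum_remainder_weight_by_parts:
  fixes B :: "nat \<Rightarrow> real"
  assumes "1 \<le> n"
  shows "(\<Sum>m\<le>M. remainder_weight n k m * B m) = (if n \<le> M then (\<Sum>i. remainder_weight n k i) * B n else 0)
    + (\<Sum>m<M. remainder_weight n (Suc k) m * fdiff B m) - remainder_weight n (Suc k) M * B M"
proof (induction M)
  case 0
  then show ?case using assms by (simp add: remainder_weight_Suc_0)
next
  case (Suc M)
  have e: "remainder_weight n k (Suc M) = remainder_weight n (Suc k) M - remainder_weight n (Suc k) (Suc M)
      + (if Suc M = n then \<Sum>i. remainder_weight n k i else 0)"
    using remainder_weight_Suc_Suc[OF assms, of k M] by simp
  show ?case
    unfolding sum.atMost_Suc sum.lessThan_Suc Suc.IH e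
    by (auto simp: fdiff_def[of B M] le_Suc_eq algebra_simps)
qed

section \<open>Expansion of the Poisson transform and size of the remainder\<close>

lemma summable_fdiff_funpow:
  assumes "\<And>x::real. summable (\<lambda>m. A m / fact m * x ^ m)"
  shows "summable (\<lambda>m. (fdiff ^^ k) A m / fact m * x ^ m)"
  by (induction k arbitrary: x) (use assms summable_fdiff in auto)

lemma summable_abs_poisson:
  assumes "\<And>x::real. summable (\<lambda>m. B m / fact m * x ^ m)" "0 \<le> r"
  shows "summable (\<lambda>m. \<bar>B m\<bar> / fact m * r ^ m)"
    "summable (\<lambda>m. poisson_weight r m * \<bar>B m\<bar>)"
    "(\<Sum>m. poisson_weight r m * \<bar>B m\<bar>) = poisson_majorant B r"
proof -
  have "summable (\<lambda>m. norm (B m / fact m * r ^ m))"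
    \<comment> \<open>Convergence at the larger point \<open>r + 1\<close> gives absolute
      convergence at \<open>r\<close>.\<close>
    by (rule powser_insidea[OF assms(1)[of "r + 1"]]) (use assms(2) in auto)
  then show s: "summable (\<lambda>m. \<bar>B m\<bar> / fact m * r ^ m)"
    using assms(2) by (simp add: abs_mult)
  have eq: "(\<lambda>m. poisson_weight r m * \<bar>B m\<bar>) = (\<lambda>m. exp (- r) * (\<bar>B m\<bar> / fact m * r ^ m))"
    by (simp add: poisson_weight_def fun_eq_iff)
  show "summable (\<lambda>m. poisson_weight r m * \<bar>B m\<bar>)"
    unfolding eq by (rule summable_mult[OF s])
  show "(\<Sum>m. poisson_weight r m * \<bar>B m\<bar>) = poisson_majorant B r"
    unfolding eq poisson_majorant_def by (rule suminf_mult[OF s])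
qed

lemma remainder_weight_sum_abs_le:
  assumes "\<And>x::real. summable (\<lambda>m. B m / fact m * x ^ m)" "1 \<le> n"
  shows "summable (\<lambda>m. remainder_weight n k m * B m)"
    "\<bar>\<Sum>m. remainder_weight n k m * B m\<bar> \<le> sqrt 2 * sqrt (real n) ^ k * poisson_majorant B (real n)"
proof -
  let ?c = "sqrt 2 * sqrt (real n) ^ k" and ?p = "poisson_weight (real n)"
  have le: "\<bar>remainder_weight n k m * B m\<bar> \<le> ?c * (?p m * \<bar>B m\<bar>)" for m
    using mult_right_mono[OF abs_remainder_weight_le[OF assms(2), of k m], of "\<bar>B m\<bar>"]
    by (simp add: abs_mult mult.assoc)
  have sp: "summable (\<lambda>m. ?p m * \<bar>B m\<bar>)"
    by (rule summable_abs_poisson[OF assms(1)]) auto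
  note s = summable_mult[OF sp, of ?c]
  have sa: "summable (\<lambda>m. \<bar>remainder_weight n k m * B m\<bar>)"
    by (rule summable_comparison_test'[OF s, of 0]) (use le in auto)
  then show "summable (\<lambda>m. remainder_weight n k m * B m)"
    by (rule summable_rabs_cancel)
  have "\<bar>\<Sum>m. remainder_weight n k m * B m\<bar> \<le> (\<Sum>m. \<bar>remainder_weight n k m * B m\<bar>)"
    by (rule summable_rabs[OF sa])
  also have "\<dots> \<le> (\<Sum>m. ?c * (?p m * \<bar>B m\<bar>))"
    by (rule suminf_le[OF le sa s])
  also have "\<dots> = ?c * poisson_majorant B (real n)"
    by (simp only: suminf_mult[OF sp] summable_abs_poisson(3)[OF assms(1) of_nat_0_le_iff])
  finally show "\<bar>\<Sum>m. remainder_weight n k m * B m\<bar> \<le> ?c * poisson_majorant B (real n)" .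
qed

text \<open>Limit of the finite formula: the boundary term is the general term of a convergent
  series, so it tends to 0.\<close>

lemma suminf_remainder_weight_by_parts:
  assumes B: "\<And>x::real. summable (\<lambda>m. B m / fact m * x ^ m)" and n: "1 \<le> n"
  shows "(\<Sum>m. remainder_weight n k m * B m)
    = (\<Sum>m. remainder_weight n k m) * B n + (\<Sum>m. remainder_weight n (Suc k) m * fdiff B m)"
proof -
  let ?t = "\<Sum>m. remainder_weight n k m"
  have "(\<lambda>M. (\<Sum>m<M. remainder_weight n (Suc k) m * fdiff B m) + ?t * B n - remainder_weight n (Suc k) M * B M)
      \<longlonglongrightarrow> (\<Sum>m. remainder_weight n (Suc k) m * fdiff B m) + ?t * B n - 0"
    by (intro tendsto_intros summable_LIMSEQ summable_LIMSEQ_zero remainder_weight_sum_abs_le(1) n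
        summable_fdiff B)
  moreover have "\<forall>\<^sub>F M in sequentially.
      (\<Sum>m<M. remainder_weight n (Suc k) m * fdiff B m) + ?t * B n - remainder_weight n (Suc k) M * B M
      = (\<Sum>m\<le>M. remainder_weight n k m * B m)"
    using eventually_ge_at_top[of n]
    by eventually_elim (simp add: sum_remainder_weight_by_parts[OF n])
  ultimately have "(\<lambda>M. \<Sum>m\<le>M. remainder_weight n k m * B m)
      \<longlonglongrightarrow> (\<Sum>m. remainder_weight n (Suc k) m * fdiff B m) + ?t * B n - 0"
    by (rule Lim_transform_eventually)
  moreover have "(\<lambda>M. \<Sum>m\<le>M. remainder_weight n k m * B m) \<longlonglongrightarrow> (\<Sum>m. remainder_weight n k m * B m)"
    by (rule summable_LIMSEQ'[OF remainder_weight_sum_abs_le(1)[OF B n]])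
  ultimately show ?thesis
    using LIMSEQ_unique by fastforce
qed

lemma poisson_transform_expansion:
  assumes A: "\<And>x::real. summable (\<lambda>m. A m / fact m * x ^ m)" and n: "1 \<le> n"
  shows "poisson_transform A (real n)
    = (\<Sum>j<k. (fdiff ^^ j) A n * (\<Sum>m. remainder_weight n j m)) + (\<Sum>m. remainder_weight n k m * (fdiff ^^ k) A m)"
proof (induction k)
  case 0
  have "remainder_weight n 0 m * A m = exp (- real n) * (A m / fact m * real n ^ m)" for m
    by (simp add: remainder_weight_def poisson_weight_def)
  then have "(\<Sum>m. remainder_weight n 0 m * A m) = poisson_transform A (real n)"
    unfolding poisson_transform_def by (simp only: suminf_mult[OF A])
  then show ?case by simp
next
  case (Suc k)
  then show ?case
    using suminf_remainder_weight_by_parts[OF summable_fdiff_funpow[OF A] n, of k k] by simp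
qed

section \<open>Identification of the coefficients with the tau polynomials\<close>

lemma fdiff_funpow_power: "(fdiff ^^ k) (\<lambda>m. (1 + z) ^ m) = (\<lambda>m. z ^ k * (1 + z) ^ m)"
  by (induction k) (auto simp: fdiff_def fun_eq_iff algebra_simps)

lemma exp_sums_fact:
  fixes x :: real
  shows "(\<lambda>m. x ^ m / fact m) sums exp x"
  using exp_converges[of x] by (simp add: field_simps)

text \<open>For a geometric sequence each difference contributes a factor \<open>z\<close>, so the
  remainder is at most a constant times \<open>(\<bar>z\<bar> * sqrt (real n)) ^ k\<close>; this
  ratio dictates the range of \<open>z\<close>.\<close>

lemma remainder_weight_generating_function:
  assumes n: "1 \<le> n" and z: "\<bar>z\<bar> * sqrt (real n) < 1"
  shows "(\<lambda>j. (\<Sum>m. remainder_weight n j m) * z ^ j) sums (((1 + z) * exp (- z)) powr (- real n))"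
proof -
  define A where "A m = (1 + z) ^ m" for m :: nat
  \<comment> \<open>The general \<open>c\<close> and \<open>w\<close> serve both the sequence itself
    and the absolute values of its differences in the majorant.\<close>
  have ex: "(\<lambda>m. (c * w ^ m) / fact m * x ^ m) sums (c * exp (w * x))" for c w x :: real
    using sums_mult[OF exp_sums_fact[of "w * x"], of c] by (simp add: power_mult_distrib mult.assoc)
  have A: "summable (\<lambda>m. A m / fact m * x ^ m)" for x
    using ex[of 1 "1 + z" x] by (simp add: A_def sums_iff)
  have fA: "(fdiff ^^ k) A = (\<lambda>m. z ^ k * (1 + z) ^ m)" for k
    unfolding A_def by (rule fdiff_funpow_power)
  have pt: "poisson_transform A (real n) = exp (real n * z)"
  proof -
    have "poisson_transform A (real n) = exp (- real n) * exp ((1 + z) * real n)"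
      using ex[of 1 "1 + z" "real n"] by (simp add: A_def poisson_transform_def sums_iff)
    then show ?thesis by (simp add: algebra_simps flip: exp_add)
  qed
  have pm: "poisson_majorant ((fdiff ^^ k) A) (real n)
      = \<bar>z\<bar> ^ k * (exp (- real n) * exp (\<bar>1 + z\<bar> * real n))" for k
    using ex[of "\<bar>z\<bar> ^ k" "\<bar>1 + z\<bar>" "real n"]
    by (simp add: fA poisson_majorant_def sums_iff abs_mult power_abs)
  let ?R = "\<lambda>k. \<Sum>m. remainder_weight n k m * (fdiff ^^ k) A m"
  let ?K = "sqrt 2 * (exp (- real n) * exp (\<bar>1 + z\<bar> * real n))"
  have R: "\<bar>?R k\<bar> \<le> ?K * (\<bar>z\<bar> * sqrt (real n)) ^ k" for k
    using remainder_weight_sum_abs_le(2)[OF summable_fdiff_funpow[OF A] n, of k k]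
    unfolding pm by (simp add: power_mult_distrib ac_simps)
  have "(\<lambda>k. ?K * (\<bar>z\<bar> * sqrt (real n)) ^ k) \<longlonglongrightarrow> ?K * 0"
    using z by (intro tendsto_intros LIMSEQ_realpow_zero) auto
  then have lim: "(\<lambda>k. ?K * (\<bar>z\<bar> * sqrt (real n)) ^ k) \<longlonglongrightarrow> 0"
    by (simp only: mult_zero_right)
  have "?R \<longlonglongrightarrow> 0"
    by (rule Lim_null_comparison[OF always_eventually lim]) (use R in simp)
  then have "(\<lambda>k. exp (real n * z) - ?R k) \<longlonglongrightarrow> exp (real n * z) - 0"
    by (intro tendsto_intros)
  moreover have "exp (real n * z) - ?R k = (\<Sum>j<k. (1 + z) ^ n * ((\<Sum>m. remainder_weight n j m) * z ^ j))" for k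
    using poisson_transform_expansion[OF A n, of k] unfolding pt by (simp add: fA ac_simps)
  ultimately have "(\<lambda>j. (1 + z) ^ n * ((\<Sum>m. remainder_weight n j m) * z ^ j)) sums exp (real n * z)"
    by (simp add: sums_def)
  \<comment> \<open>Positivity permits division by \<open>(1 + z) ^ n\<close> and its rewriting as a
    real power.\<close>
  moreover have z1: "0 < 1 + z"
  proof -
    have "\<bar>z\<bar> * 1 \<le> \<bar>z\<bar> * sqrt (real n)"
      using n by (intro mult_left_mono) auto
    then show ?thesis using z by linarith
  qed
  ultimately have "(\<lambda>j. (\<Sum>m. remainder_weight n j m) * z ^ j) sums (exp (real n * z) / (1 + z) ^ n)"
    using sums_divide[of _ "exp (real n * z)" "(1 + z) ^ n"] by fastforce
  also have "exp (real n * z) / (1 + z) ^ n = ((1 + z) * exp (- z)) powr (- real n)"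
    using z1 by (simp add: powr_mult powr_minus powr_realpow exp_minus field_simps exp_of_nat2_mult)
  finally show ?thesis .
qed

lemma suminf_remainder_weight_eq_tau:
  assumes n: "1 \<le> n"
  shows "(\<Sum>m. remainder_weight n j m) = tau j (- real n) / fact j"
proof -
  \<comment> \<open>\<open>powser_coeff_zero\<close> asks for the whole unit disc, but the series of
    masses is identified only for \<open>\<bar>z\<bar> < \<rho>\<close>; substituting
    \<open>z = \<rho> * y\<close> reconciles the two.\<close>
  define \<rho> where "\<rho> = 1 / sqrt (real n)"
  have \<rho>: "0 < \<rho>" "\<rho> \<le> 1" "\<rho> * sqrt (real n) = 1"
    using n by (auto simp: \<rho>_def)
  let ?t = "\<lambda>j. \<Sum>m. remainder_weight n j m"
  let ?d = "\<lambda>j. (?t j - tau j (- real n) / fact j) * \<rho> ^ j"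
  have "(\<lambda>j. ?d j * y ^ j) sums 0" if y: "\<bar>y\<bar> < 1" for y
  proof -
    have "\<bar>\<rho> * y\<bar> * sqrt (real n) = \<bar>y\<bar>"
      using \<rho> by (simp add: abs_mult \<rho>_def)
    then have 1: "(\<lambda>j. ?t j * (\<rho> * y) ^ j) sums (((1 + \<rho> * y) * exp (- (\<rho> * y))) powr (- real n))"
      by (intro remainder_weight_generating_function n) (simp add: y)
    have "\<rho> * \<bar>y\<bar> \<le> 1 * \<bar>y\<bar>"
      using \<rho> by (intro mult_right_mono) auto
    then have "\<bar>\<rho> * y\<bar> < 1"
      using \<rho> y by (simp add: abs_mult)
    from sums_diff[OF 1 tau_sums[OF this, of "- real n"]] show ?thesis
      by (simp add: power_mult_distrib algebra_simps)
  qed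
  from powser_coeff_zero[OF this, of j] show ?thesis
    using \<rho> by simp
qed

theorem theorem4:
  fixes A :: "nat \<Rightarrow> real" and N n :: nat
  assumes "\<And>x::real. summable (\<lambda>m. A m / fact m * x ^ m)"
    and "n \<ge> 2"
  shows "\<bar>poisson_transform A (real n)
            - (\<Sum>m=0..N. (fdiff ^^ m) A n / fact m * tau m (- real n))\<bar>
         \<le> 9 * (real N + 1) * real n powr ((real N + 1) / 2)
            * poisson_majorant ((fdiff ^^ (N + 1)) A) (real n)"
proof -
  have n: "1 \<le> n" using assms(2) by simp
  let ?k = "N + 1"
  let ?B = "(fdiff ^^ ?k) A"
  note B = summable_fdiff_funpow[OF assms(1), of ?k]
  have "(\<Sum>m=0..N. (fdiff ^^ m) A n / fact m * tau m (- real n))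
      = (\<Sum>j<?k. (fdiff ^^ j) A n * (\<Sum>m. remainder_weight n j m))"
    by (intro sum.cong) (auto simp: suminf_remainder_weight_eq_tau[OF n])
  then have "\<bar>poisson_transform A (real n)
            - (\<Sum>m=0..N. (fdiff ^^ m) A n / fact m * tau m (- real n))\<bar>
      = \<bar>\<Sum>m. remainder_weight n ?k m * ?B m\<bar>"
    using poisson_transform_expansion[OF assms(1) n, of ?k] by simp
  also have "\<dots> \<le> sqrt 2 * sqrt (real n) ^ ?k * poisson_majorant ?B (real n)"
    by (rule remainder_weight_sum_abs_le(2)[OF B n])
  also have "sqrt (real n) ^ ?k = real n powr ((real N + 1) / 2)"
    
  proof -
    have "sqrt (real n) ^ ?k = (real n powr (1/2)) powr real ?k"
      using n powr_realpow[of "sqrt (real n)" ?k] by (simp only: powr_half_sqrt) simp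
    then show ?thesis by (simp add: powr_powr add.commute)
  qed
  \<comment> \<open>The estimate obtained has the constant \<open>sqrt 2\<close> for every
    \<open>N\<close>; nonnegativity of the majorant allows enlarging it to the stated one.\<close>
  also have "sqrt 2 * real n powr ((real N + 1) / 2) * poisson_majorant ?B (real n)
      \<le> 9 * (real N + 1) * real n powr ((real N + 1) / 2) * poisson_majorant ?B (real n)"
  proof (intro mult_right_mono)
    have "sqrt 2 \<le> 9"
      by (rule real_le_lsqrt) auto
    then show "sqrt 2 \<le> 9 * (real N + 1)"
      using of_nat_0_le_iff[of N, where ?'a = real] by argo
    show "0 \<le> poisson_majorant ?B (real n)"
      unfolding poisson_majorant_def
      by (intro mult_nonneg_nonneg suminf_nonneg summable_abs_poisson(1)[OF B]) auto
  qed simp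
  finally show ?thesis .
qed

end
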